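(* For all integers $n,k \geq 2$, every tournament on $n$ vertices contains (as a subgraph) the $k$-th power of a directed path of length $\ell$ for some $\ell \geq \frac{n}{2^{6k+7}}$. Equivalently, $\ell(n,k) \geq \frac{n}{2^{6k+7}}$.
   Context: For integers $\ell \geq 0$ and $k \geq 1$, the $k$-th power $P_\ell^k$ of a directed path of length $\ell$ is the directed graph with vertex set $\{0,1,\ldots,\ell\}$ whose directed edges are exactly the pairs $(i,j)$ with $i < j \leq i+k$. A tournament contains $P_\ell^k$ if there is an injective map $\phi$ from $\{0,\ldots,\ell\}$ to its vertex set such that for every edge $(i,j)$ of $P_\ell^k$ the tournament has the edge oriented from $\phi(i)$ to $\phi(j)$. $\ell(n,k)$ denotes the largest $\ell$ such that every tournament on $n$ vertices contains $P_\ell^k$. *)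

theory Defs
  imports Complex_Main "Graph_Theory.Pair_Digraph"
begin

locale tournament = pair_digraph +
  assumes one_orientation:
    "\<lbrakk>u \<in> pverts G; v \<in> pverts G; u \<noteq> v\<rbrakk> \<Longrightarrow> (u, v) \<in> parcs G \<longleftrightarrow> (v, u) \<notin> parcs G"

definition path_power :: "nat \<Rightarrow> nat \<Rightarrow> nat pair_pre_digraph" where
  "path_power l k =
    \<lparr>pverts = {0..l}, parcs = {(i, j). i \<in> {0..l} \<and> j \<in> {0..l} \<and> i < j \<and> j \<le> i + k}\<rparr>"

definition contains_digraph :: "'a pair_pre_digraph \<Rightarrow> 'b pair_pre_digraph \<Rightarrow> bool" where
  "contains_digraph G H \<longleftrightarrow>
    (\<exists>\<phi>. inj_on \<phi> (pverts H) \<and> \<phi> ` pverts H \<subseteq> pverts G \<and>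
      (\<forall>(i, j) \<in> parcs H. (\<phi> i, \<phi> j) \<in> parcs G))"

text \<open>
  Every finite tournament is isomorphic to one whose vertices are natural numbers, so it
  suffices to quantify over those. For \<open>n \<ge> 1\<close> the greatest element exists, see
  \<open>max_path_power_iff\<close> below.
\<close>
definition max_path_power :: "nat \<Rightarrow> nat \<Rightarrow> nat" where
  "max_path_power n k =
    (GREATEST l. \<forall>T :: nat pair_pre_digraph.
      tournament T \<and> card (pverts T) = n \<longrightarrow> contains_digraph T (path_power l k))"

lemma contains_path_power_mono:
  assumes "contains_digraph T (path_power l k)" "l' \<le> l"
  shows "contains_digraph T (path_power l' k)"
proof -
  obtain f where f: "inj_on f {0..l}" "f ` {0..l} \<subseteq> pverts T"
    "\<forall>(i, j) \<in> parcs (path_power l k). (f i, f j) \<in> parcs T"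
    using assms(1) by (auto simp: contains_digraph_def path_power_def)
  have "inj_on f {0..l'}" using f(1) assms(2) by (auto intro: inj_on_subset)
  moreover have "f ` {0..l'} \<subseteq> pverts T" using f(2) assms(2) by auto
  moreover have "\<forall>(i, j) \<in> parcs (path_power l' k). (f i, f j) \<in> parcs T"
    using f(3) assms(2) by (auto simp: path_power_def)
  ultimately show ?thesis by (auto simp: contains_digraph_def path_power_def)
qed

lemma max_path_power_iff:
  assumes "n \<ge> 1"
  shows "l \<le> max_path_power n k \<longleftrightarrow>
    (\<forall>T :: nat pair_pre_digraph.
      tournament T \<and> card (pverts T) = n \<longrightarrow> contains_digraph T (path_power l k))"
    (is "_ \<longleftrightarrow> ?P l")
proof -
  let ?T = "\<lparr>pverts = {..<n}, parcs = {(i, j). i < j \<and> j < n}\<rparr> :: nat pair_pre_digraph"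
  have "finite {(i, j). i < j \<and> j < n}"
    by (rule finite_subset[of _ "{..<n} \<times> {..<n}"]) auto
  then have T: "tournament ?T" by unfold_locales auto
  have bound: "l \<le> n" if "?P l" for l
  proof -
    have "contains_digraph ?T (path_power l k)" using that T by simp
    then obtain f where "inj_on f {0..l}" "f ` {0..l} \<subseteq> {..<n}"
      by (auto simp: contains_digraph_def path_power_def)
    then have "card {0..l} \<le> card {..<n}" by (intro card_inj_on_le) auto
    then show ?thesis by simp
  qed
  have "?P 0"
  proof (intro allI impI)
    fix T :: "nat pair_pre_digraph" assume "tournament T \<and> card (pverts T) = n"
    then obtain v where "v \<in> pverts T" using assms by fastforce
    then show "contains_digraph T (path_power 0 k)"
      by (auto simp: contains_digraph_def path_power_def)
  qed
  then have max: "?P (max_path_power n k)"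
    unfolding max_path_power_def by (rule GreatestI_nat) (use bound in blast)
  show ?thesis
  proof
    assume "l \<le> max_path_power n k"
    with max show "?P l" using contains_path_power_mono by blast
  next
    assume "?P l"
    then show "l \<le> max_path_power n k"
      unfolding max_path_power_def by (rule Greatest_le_nat) (use bound in blast)
  qed
qed

end

theory Submission
  imports Defs
begin

text \<open>
  Order the vertices so that the number of forward arcs is maximal. Then every vertex dominates at
  least half of any interval that starts right after it. Put \<open>M = 2 ^ (6 * k)\<close> and suppose that
  \<open>U\<close> is a set of \<open>2 ^ (3 * k)\<close> vertices inside an interval of length \<open>M\<close>. It contains a transitive
  set \<open>S\<close> of size \<open>3 * k\<close>, and each vertex of \<open>S\<close> dominates at least a third of the next \<open>3 * M\<close>
  vertices. By double counting, some \<open>k\<close>-subset \<open>X\<close> of \<open>S\<close> has at least \<open>3 * M / 2 ^ (3 * k)\<close> common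
  out-neighbours there, hence \<open>2 ^ (3 * k)\<close> of them in a single interval of length \<open>M\<close>, and the
  argument can be repeated. The transitive \<open>k\<close>-sets \<open>X\<close> found in this way, each dominating the next
  one, concatenate to the \<open>k\<close>-th power of a path that picks up \<open>k\<close> vertices in every \<open>3 * M\<close> steps.
\<close>

section \<open>Path powers as lists, and orderings of median type\<close>

definition power_list :: "nat \<Rightarrow> ('a \<Rightarrow> 'a \<Rightarrow> bool) \<Rightarrow> 'a list \<Rightarrow> bool" where
  "power_list k E p \<longleftrightarrow> (\<forall>j < length p. \<forall>i < j. j \<le> i + k \<longrightarrow> E (p ! i) (p ! j))"

text \<open>This is one half of the local property of a median order. Stating it through list
  decompositions makes it pass to suffixes at once.\<close>

definition feedback :: "('a \<Rightarrow> 'a \<Rightarrow> bool) \<Rightarrow> 'a list \<Rightarrow> bool" where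
  "feedback E xs \<longleftrightarrow>
    (\<forall>ys v zs ws. xs = ys @ v # zs @ ws \<longrightarrow> length zs \<le> 2 * length (filter (E v) zs))"

fun forward_arcs :: "('a \<Rightarrow> 'a \<Rightarrow> bool) \<Rightarrow> 'a list \<Rightarrow> nat" where
  "forward_arcs E [] = 0"
| "forward_arcs E (x # xs) = length (filter (E x) xs) + forward_arcs E xs"

lemma forward_arcs_append:
  "forward_arcs E (xs @ ys) =
    forward_arcs E xs + forward_arcs E ys + (\<Sum>x\<leftarrow>xs. length (filter (E x) ys))"
  by (induction xs) auto

text \<open>Moving \<open>v\<close> behind \<open>zs\<close> only affects the pairs formed by
  \<open>v\<close> and an entry of \<open>zs\<close>. Both counts are added so that no
  natural-number subtraction occurs.\<close>

lemma forward_arcs_move: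
  "forward_arcs E (ys @ zs @ v # ws) + length (filter (E v) zs) =
   forward_arcs E (ys @ v # zs @ ws) + length (filter (\<lambda>z. E z v) zs)"
proof -
  have "(\<Sum>x\<leftarrow>zs. length (filter (E x) (v # ws))) =
      length (filter (\<lambda>z. E z v) zs) + (\<Sum>x\<leftarrow>zs. length (filter (E x) ws))"
    by (induction zs) auto
  moreover have "(\<Sum>x\<leftarrow>ys. length (filter (E x) (zs @ v # ws))) =
      (\<Sum>x\<leftarrow>ys. length (filter (E x) (v # zs @ ws)))"
    by (induction ys) auto
  ultimately show ?thesis
    by (simp add: forward_arcs_append)
qed

lemma feedback_ordering_exists:
  assumes "finite V" and tour: "\<And>u v. u \<in> V \<Longrightarrow> v \<in> V \<Longrightarrow> u \<noteq> v \<Longrightarrow> E u v \<longleftrightarrow> \<not> E v u"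
  obtains xs where "distinct xs" "set xs = V" "feedback E xs"
proof -
  let ?O = "{xs. set xs = V \<and> distinct xs}"
  have "finite ?O"
    using finite_subset_distinct[OF assms(1)] by (rule rev_finite_subset) auto
  moreover have "?O \<noteq> {}" using finite_distinct_list[OF assms(1)] by auto
  ultimately obtain xs where "xs \<in> ?O" and Max: "Max (forward_arcs E ` ?O) = forward_arcs E xs"
    by (rule obtains_MAX[where f = "forward_arcs E"]) metis
  then have xs: "set xs = V" "distinct xs" by auto
  have max: "forward_arcs E ys \<le> forward_arcs E xs" if "set ys = V" "distinct ys" for ys
    unfolding Max[symmetric] using that \<open>finite ?O\<close> by (intro Max_ge) auto
  have "feedback E xs"
    unfolding feedback_def
  proof (intro allI impI)
    fix ys v zs ws assume eq: "xs = ys @ v # zs @ ws"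
    have "forward_arcs E (ys @ zs @ v # ws) \<le> forward_arcs E xs"
      using xs eq by (intro max) auto
    \<comment> \<open>Moving \<open>v\<close> behind \<open>zs\<close> cannot beat the maximum, so
      it loses at least as many forward arcs as it gains.\<close>
    then have "length (filter (\<lambda>z. E z v) zs) \<le> length (filter (E v) zs)"
      using forward_arcs_move[of E ys zs v ws] eq by simp
    moreover have "filter (\<lambda>z. E z v) zs = filter (\<lambda>z. \<not> E v z) zs"
      using xs eq by (intro filter_cong refl tour) auto
    ultimately show "length zs \<le> 2 * length (filter (E v) zs)"
      using sum_length_filter_compl[of "E v" zs] by simp
  qed
  with xs that show thesis by blast
qed

lemma feedback_suffix: "feedback E (xs @ ys) \<Longrightarrow> feedback E ys"
  unfolding feedback_def by (metis append_assoc)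

section \<open>Transitive sets and common out-neighbours\<close>

text \<open>Induction: a transitive list in the out-neighbourhood of a vertex \<open>v\<close> can
  be extended by \<open>v\<close> in front, one in the in-neighbourhood by \<open>v\<close> at the
  end.\<close>

lemma transitive_sublist:
  assumes "finite U" "2 ^ m \<le> card U"
    and "\<And>u v. u \<in> U \<Longrightarrow> v \<in> U \<Longrightarrow> u \<noteq> v \<Longrightarrow> E u v \<or> E v u"
  shows "\<exists>xs. distinct xs \<and> set xs \<subseteq> U \<and> length xs = m \<and> sorted_wrt E xs"
  using assms
proof (induction m arbitrary: U)
  case 0
  show ?case by (intro exI[of _ "[]"]) auto
next
  case (Suc m)
  then obtain v where v: "v \<in> U" by fastforce
  let ?P = "{u \<in> U - {v}. E v u}" and ?Q = "{u \<in> U - {v}. E u v}"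
  have "U - {v} = ?P \<union> ?Q" using Suc.prems(3) v by blast
  then have "card U \<le> Suc (card (?P \<union> ?Q))"
    using card_Suc_Diff1[OF Suc.prems(1) v] by (simp only: order_refl)
  also have "\<dots> \<le> Suc (card ?P + card ?Q)" by (simp add: card_Un_le)
  \<comment> \<open>Otherwise \<open>card U\<close> would be at most 1 + 2 * (2 ^ m - 1), which is
    less than 2 ^ (m + 1).\<close>
  finally have "2 ^ m \<le> card ?P \<or> 2 ^ m \<le> card ?Q" using Suc.prems(2) by auto
  then show ?case
  proof
    assume "2 ^ m \<le> card ?P"
    then obtain xs where "distinct xs" "set xs \<subseteq> ?P" "length xs = m" "sorted_wrt E xs"
      using Suc.IH[of ?P] Suc.prems by auto
    then show ?thesis using v by (intro exI[of _ "v # xs"]) auto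
  next
    assume "2 ^ m \<le> card ?Q"
    then obtain xs where "distinct xs" "set xs \<subseteq> ?Q" "length xs = m" "sorted_wrt E xs"
      using Suc.IH[of ?Q] Suc.prems by auto
    then show ?thesis using v by (intro exI[of _ "xs @ [v]"]) (auto simp: sorted_wrt_append)
  qed
qed

text \<open>A linear lower bound for the binomial coefficient, which replaces a convexity argument
  in the double counting. By Pascal's rule the coefficient grows by at least 1 per step once
  \<open>d\<close> \<ge> \<open>k\<close> - 1; for smaller \<open>d\<close> the summand
  \<open>k\<close> suffices.\<close>

lemma Suc_le_binomial_plus:
  assumes "k \<ge> 1" shows "Suc d \<le> (d choose k) + k"
proof (induction d)
  case 0
  then show ?case using assms by simp
next
  case (Suc d)
  obtain j where j: "k = Suc j" using assms by (cases k) auto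
  show ?case
  proof (cases "j \<le> d")
    case True
    then have "(d choose j) > 0" by simp
    then show ?thesis using Suc j by (simp del: zero_less_binomial_iff)
  next
    case False
    then show ?thesis using j by simp
  qed
qed

text \<open>Count pairs of a vertex \<open>w\<close> and a \<open>k\<close>-subset of
  \<open>S\<close> dominating it. A vertex of \<open>W\<close> has on average at least
  \<open>k\<close> in-neighbours in \<open>S\<close>, so the linear bound yields at least one pair
  per vertex on average; now average over the at most 2 ^ (3 * \<open>k\<close>) subsets.\<close>

lemma exists_subset_many_common_neighbours:
  assumes "finite S" "finite W" "k \<ge> 1" "card S = 3 * k" "card W = 3 * M"
    and deg: "\<And>u. u \<in> S \<Longrightarrow> M \<le> card {w \<in> W. E u w}"
  obtains X where "X \<subseteq> S" "card X = k" "3 * M \<le> 2 ^ (3 * k) * card {w \<in> W. \<forall>x \<in> X. E x w}"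
proof -
  let ?X = "{X. X \<subseteq> S \<and> card X = k}"
  let ?d = "\<lambda>w. card {u \<in> S. E u w}"
  have fin: "finite ?X" using assms(1) by auto
  have "3 * k * M = (\<Sum>u\<in>S. M)" using assms by simp
  also have "\<dots> \<le> (\<Sum>u\<in>S. card {w \<in> W. E u w})" using deg by (rule sum_mono)
  also have "\<dots> = (\<Sum>w\<in>W. ?d w)"
    using assms(1,2) by (intro sum_multicount_gen) auto
  finally have "3 * k * M + 3 * M \<le> (\<Sum>w\<in>W. Suc (?d w))"
    unfolding Suc_eq_plus1 sum.distrib using assms(5) by simp
  also have "\<dots> \<le> (\<Sum>w\<in>W. (?d w choose k) + k)"
    using Suc_le_binomial_plus[OF assms(3)] by (intro sum_mono)
  also have "\<dots> = (\<Sum>w\<in>W. ?d w choose k) + 3 * k * M"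
    using assms(5) by (simp add: sum.distrib)
  finally have "3 * M \<le> (\<Sum>w\<in>W. ?d w choose k)" by simp
  also have "\<dots> = (\<Sum>w\<in>W. card {X \<in> ?X. \<forall>x \<in> X. E x w})"
  proof (rule sum.cong[OF refl])
    fix w
    have "{X \<in> ?X. \<forall>x \<in> X. E x w} = {X. X \<subseteq> {u \<in> S. E u w} \<and> card X = k}" by auto
    then show "?d w choose k = card {X \<in> ?X. \<forall>x \<in> X. E x w}"
      using n_subsets[of "{u \<in> S. E u w}" k] assms(1) by simp
  qed
  also have "\<dots> = (\<Sum>X\<in>?X. card {w \<in> W. \<forall>x \<in> X. E x w})"
    using fin assms(2) by (intro sum_multicount_gen) auto
  finally have le: "3 * M \<le> (\<Sum>X\<in>?X. card {w \<in> W. \<forall>x \<in> X. E x w})" .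
  have card: "card ?X \<le> 2 ^ (3 * k)" "card ?X > 0"
    using n_subsets[OF assms(1), of k] assms(4) by (auto simp: binomial_le_pow2)
  have "\<exists>X \<in> ?X. 3 * M \<le> 2 ^ (3 * k) * card {w \<in> W. \<forall>x \<in> X. E x w}"
  proof (rule ccontr)
    assume "\<not> ?thesis"
    then have "(\<Sum>X\<in>?X. 2 ^ (3 * k) * card {w \<in> W. \<forall>x \<in> X. E x w}) < (\<Sum>X\<in>?X. 3 * M)"
      using fin card(2) by (intro sum_strict_mono) (auto simp: not_le card_gt_0_iff)
    also have "\<dots> \<le> 2 ^ (3 * k) * (3 * M)" using card(1) by simp
    finally show False using le by (simp flip: sum_distrib_left)
  qed
  then show thesis using that by auto
qed

section \<open>Building the path power block by block\<close>

lemma pigeonhole_three_blocks: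
  assumes "length W = 3 * M" "3 * s \<le> card (N \<inter> set W)"
  obtains P B Q where "W = P @ B @ Q" "length B = M" "s \<le> card (N \<inter> set B)"
proof -
  let ?A = "take M W" and ?B = "take M (drop M W)" and ?C = "drop M (drop M W)"
  have W: "W = ?A @ ?B @ ?C" by (simp only: append_take_drop_id)
  have "N \<inter> set W = (N \<inter> set ?A) \<union> (N \<inter> set ?B) \<union> (N \<inter> set ?C)"
    by (subst W) auto
  then have "3 * s \<le> card (N \<inter> set ?A) + card (N \<inter> set ?B) + card (N \<inter> set ?C)"
    using assms(2) card_Un_le[of "(N \<inter> set ?A) \<union> (N \<inter> set ?B)" "N \<inter> set ?C"]
      card_Un_le[of "N \<inter> set ?A" "N \<inter> set ?B"] by (simp only:)
  then consider "s \<le> card (N \<inter> set ?A)" | "s \<le> card (N \<inter> set ?B)" | "s \<le> card (N \<inter> set ?C)"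
    by linarith
  then show thesis
  proof cases
    case 1
    then show ?thesis using that[of "[]" ?A "?B @ ?C"] W assms(1) by simp
  next
    case 2
    then show ?thesis using that[of ?A ?B ?C] W assms(1) by simp
  next
    case 3
    then show ?thesis using that[of "?A @ ?B" ?C "[]"] W assms(1) by simp
  qed
qed

lemma power_list_append:
  assumes "sorted_wrt E A" "length A = k" "power_list k E p" "k \<le> length p"
    and dom: "\<And>x y. x \<in> set A \<Longrightarrow> y \<in> set (take k p) \<Longrightarrow> E x y"
  shows "power_list k E (A @ p)"
  unfolding power_list_def
proof (intro allI impI)
  fix i j assume j: "j < length (A @ p)" and ij: "i < j" "j \<le> i + k"
  consider "j < k" | "i < k" "k \<le> j" | "k \<le> i" by linarith
  then show "E ((A @ p) ! i) ((A @ p) ! j)"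
  proof cases
    case 1
    then show ?thesis
      using assms(1,2) ij by (simp add: nth_append sorted_wrt_iff_nth_less)
  next
    case 2
    \<comment> \<open>An arc from \<open>A\<close> into \<open>p\<close> ends among the first
      \<open>k\<close> entries of \<open>p\<close>, where \<open>dom\<close> applies.\<close>
    then have "j - k < k" "j - k < length p" using ij j assms(2) by auto
    then have "p ! (j - k) \<in> set (take k p)" by (auto simp: in_set_conv_nth)
    then show ?thesis using dom 2 assms(2) by (simp add: nth_append)
  next
    case 3
    then have "E (p ! (i - k)) (p ! (j - k))"
      using assms(2,3) ij j unfolding power_list_def by auto
    then show ?thesis using 3 ij assms(2) by (simp add: nth_append)
  qed
qed

text \<open>If b \<le> \<open>M\<close> entries of \<open>B\<close> follow \<open>v\<close>, then
  \<open>v\<close> dominates at least (b + 3 * \<open>M\<close>) / 2 of these and \<open>W\<close>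
  together, hence at least (3 * \<open>M\<close> - b) / 2 \<ge> \<open>M\<close> in
  \<open>W\<close>.\<close>

lemma feedback_degree_next_block:
  assumes "feedback E (B @ W @ rest)" "distinct (B @ W @ rest)" "v \<in> set B"
    "length B = M" "length W = 3 * M"
  shows "M \<le> card {w \<in> set W. E v w}"
proof -
  obtain B1 B2 where B: "B = B1 @ v # B2" using split_list assms(3) by metis
  have "length (B2 @ W) \<le> 2 * length (filter (E v) (B2 @ W))"
    using assms(1) unfolding feedback_def B
    by (elim allE[of _ B1] allE[of _ v] allE[of _ "B2 @ W"] allE[of _ rest]) simp
  moreover have "length (filter (E v) B2) \<le> length B2" by simp
  moreover have "length B2 \<le> M" using assms(4) B by simp
  ultimately have "M \<le> length (filter (E v) W)"
    unfolding length_append filter_append assms(5) by presburger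
  also have "\<dots> = card (set (filter (E v) W))"
    using assms(2) by (simp only: distinct_card distinct_filter distinct_append)
  finally show ?thesis by simp
qed

text \<open>The induction builds the list from its end. Requiring its first \<open>k\<close> entries
  to lie in the prescribed set \<open>U\<close> is what allows a dominating \<open>k\<close>-set to
  be put in front.\<close>

lemma power_list_from_block:
  assumes "k \<ge> 1" "M = 2 ^ (6 * k)"
    and tot: "\<And>u v. u \<in> V \<Longrightarrow> v \<in> V \<Longrightarrow> u \<noteq> v \<Longrightarrow> E u v \<or> E v u"
    and "feedback E (B @ rest)" "distinct (B @ rest)" "set (B @ rest) \<subseteq> V"
    and "length B = M" "U \<subseteq> set B" "2 ^ (3 * k) \<le> card U" "3 * M * t \<le> length rest"
  shows "\<exists>p. power_list k E p \<and> distinct p \<and> length p = k * Suc t \<and>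
    set p \<subseteq> set (B @ rest) \<and> set (take k p) \<subseteq> U"
  using assms(4-)
proof (induction t arbitrary: B rest U)
  case 0
  have "finite U" using 0 by (auto intro: finite_subset)
  moreover have "2 ^ k \<le> card U"
    using 0(6) power_increasing[of k "3 * k" "2::nat"] by linarith
  moreover have "E u v \<or> E v u" if "u \<in> U" "v \<in> U" "u \<noteq> v" for u v
    using tot[of u v] 0(3,5) that by auto
  ultimately obtain p where "distinct p" "set p \<subseteq> U" "length p = k" "sorted_wrt E p"
    using transitive_sublist[of U k E] by auto
  then show ?case
    using 0 by (intro exI[of _ p]) (auto simp: power_list_def sorted_wrt_iff_nth_less)
next
  case (Suc t)
  have finU: "finite U" using Suc.prems by (auto intro: finite_subset)
  define W where "W = take (3 * M) rest"
  define R where "R = drop (3 * M) rest"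
  have rest: "rest = W @ R" by (simp add: W_def R_def)
  have lenW: "length W = 3 * M" using Suc.prems(7) by (simp add: W_def)
  have lenR: "3 * M * t \<le> length R" using Suc.prems(7) by (simp add: R_def)
  have "E u v \<or> E v u" if "u \<in> U" "v \<in> U" "u \<noteq> v" for u v
    using tot[of u v] Suc.prems(3,5) that by auto
  then obtain L where L: "distinct L" "set L \<subseteq> U" "length L = 3 * k" "sorted_wrt E L"
    using transitive_sublist[OF finU Suc.prems(6), of E] by auto
  have "M \<le> card {w \<in> set W. E u w}" if "u \<in> set L" for u
    using feedback_degree_next_block[of E B W R u M] Suc.prems L(2) lenW that rest by auto
  moreover have "card (set L) = 3 * k" "card (set W) = 3 * M"
    using L distinct_card Suc.prems(2) lenW rest by (auto simp: distinct_card)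
  ultimately obtain X where X: "X \<subseteq> set L" "card X = k"
    and large: "3 * M \<le> 2 ^ (3 * k) * card {w \<in> set W. \<forall>x \<in> X. E x w}"
    using exists_subset_many_common_neighbours[of "set L" "set W" k M E] assms(1) by auto
  define N where "N = {w \<in> set W. \<forall>x \<in> X. E x w}"
  \<comment> \<open>One factor 2 ^ (3 * \<open>k\<close>) pays for the choice of \<open>X\<close>;
    the other is the size needed for the next \<open>U\<close>.\<close>
  have "M = 2 ^ (3 * k) * 2 ^ (3 * k)" using assms(2) by (simp flip: power_add)
  then have "3 * 2 ^ (3 * k) \<le> card (N \<inter> set W)"
    using large by (simp add: N_def Int_def conj_commute conj_left_commute)
  then obtain P B' Q where W: "W = P @ B' @ Q" "length B' = M" "2 ^ (3 * k) \<le> card (N \<inter> set B')"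
    using pigeonhole_three_blocks lenW by metis
  have "feedback E (B' @ Q @ R)"
    using Suc.prems(1) feedback_suffix[of E "B @ P" "B' @ Q @ R"] rest W by simp
  then obtain p where p: "power_list k E p" "distinct p" "length p = k * Suc t"
    "set p \<subseteq> set (B' @ Q @ R)" "set (take k p) \<subseteq> N \<inter> set B'"
    using Suc.IH[of B' "Q @ R" "N \<inter> set B'"] Suc.prems(2,3) rest W lenR by auto
  \<comment> \<open>Filtering \<open>L\<close> lists \<open>X\<close> in transitive order.\<close>
  define A where "A = filter (\<lambda>x. x \<in> X) L"
  have setA: "set A = X" using X by (auto simp: A_def)
  have A: "distinct A" "sorted_wrt E A" using L by (auto simp: A_def sorted_wrt_filter)
  have lenA: "length A = k" using distinct_card[OF A(1)] setA X by simp
  have "power_list k E (A @ p)"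
    using A(2) lenA p(1,3,5) setA by (intro power_list_append) (auto simp: N_def)
  moreover have "set A \<subseteq> set B" "set A \<subseteq> U" using setA X L(2) Suc.prems(5) by auto
  moreover have "distinct (A @ p)"
    using A(1) p(2,4) calculation(2) Suc.prems(2) rest W by auto
  ultimately show ?case
    using p lenA rest W by (intro exI[of _ "A @ p"]) auto
qed

lemma contains_path_power_of_power_list:
  assumes "power_list k (\<lambda>u v. (u, v) \<in> parcs T) p" "distinct p" "set p \<subseteq> pverts T"
    and "length p = Suc l"
  shows "contains_digraph T (path_power l k)"
  unfolding contains_digraph_def
proof (intro exI[of _ "(!) p"] conjI)
  show "inj_on ((!) p) (pverts (path_power l k))"
    using assms by (auto simp: path_power_def intro!: inj_on_nth)
  show "(!) p ` pverts (path_power l k) \<subseteq> pverts T"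
    using assms nth_mem by (fastforce simp: path_power_def)
  show "\<forall>(i, j) \<in> parcs (path_power l k). (p ! i, p ! j) \<in> parcs T"
    using assms by (auto simp: path_power_def power_list_def)
qed

lemma tournament_contains_long_path_power:
  assumes "tournament T" "card (pverts T) = n" "n \<ge> 2" "k \<ge> 2"
  shows "\<exists>l. n \<le> 2 ^ (6 * k + 7) * l \<and> contains_digraph T (path_power l k)"
proof -
  interpret tournament T by fact
  define E where "E = (\<lambda>u v. (u, v) \<in> parcs T)"
  define M :: nat where "M = 2 ^ (6 * k)"
  have M: "2 ^ (6 * k + 7) = 128 * M" by (simp add: M_def power_add)
  have fin: "finite (pverts T)" using assms by (auto intro: card_ge_0_finite)
  have tour: "E u v \<longleftrightarrow> \<not> E v u" if "u \<in> pverts T" "v \<in> pverts T" "u \<noteq> v" for u v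
    using one_orientation[OF that] by (simp only: E_def)
  have "\<exists>p l. power_list k E p \<and> distinct p \<and> set p \<subseteq> pverts T \<and> length p = Suc l \<and> n \<le> 128 * M * l"
  proof (cases "n < M")
    case True
    obtain u v where "u \<in> pverts T" "v \<in> pverts T" "u \<noteq> v"
      using assms(2,3) card_le_Suc0_iff_eq[OF fin] by auto
    then obtain x y where "x \<in> pverts T" "y \<in> pverts T" "x \<noteq> y" "E x y"
      using tour[of u v] by blast
    then have "power_list k E [x, y]" "distinct [x, y]" "set [x, y] \<subseteq> pverts T"
      by (auto simp: power_list_def less_Suc_eq)
    \<comment> \<open>For \<open>n\<close> < \<open>M\<close> a single arc, that is \<open>l\<close>
      = 1, is long enough.\<close>
    then show ?thesis using True by (intro exI[of _ "[x, y]"] exI[of _ 1]) simp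
  next
    case False
    obtain xs where xs: "distinct xs" "set xs = pverts T" "feedback E xs"
      using feedback_ordering_exists[of "pverts T" E] fin tour by metis
    have len: "length xs = n" using xs assms(2) distinct_card by metis
    define t where "t = (n - M) div (3 * M)"
    have "M > 0" by (simp add: M_def)
    then have t: "3 * M * t \<le> n - M" "n - M < 3 * M * Suc t"
      unfolding t_def by (simp_all add: dividend_less_times_div)
    have "card (set (take M xs)) = M"
      using xs(1) len False by (simp add: distinct_card)
    moreover have "(2::nat) ^ (3 * k) \<le> M" unfolding M_def by (intro power_increasing) auto
    ultimately have block: "2 ^ (3 * k) \<le> card (set (take M xs))" by simp
    have tot: "E u v \<or> E v u" if "u \<in> pverts T" "v \<in> pverts T" "u \<noteq> v" for u v
      using tour[OF that] by blast
    have "\<exists>p. power_list k E p \<and> distinct p \<and> length p = k * Suc t \<and>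
        set p \<subseteq> set (take M xs @ drop M xs) \<and> set (take k p) \<subseteq> set (take M xs)"
      by (rule power_list_from_block[where V = "pverts T", OF _ M_def tot])
         (use xs t(1) len False assms(4) block in simp_all)
    then obtain p where p: "power_list k E p" "distinct p" "length p = k * Suc t"
      "set p \<subseteq> pverts T"
      unfolding append_take_drop_id xs(2) by blast
    have "2 * Suc t \<le> k * Suc t" using assms(4) by (rule mult_le_mono1)
    then have "2 * Suc t \<le> length p" by (simp only: p(3))
    then obtain l where l: "length p = Suc l" "2 * t + 1 \<le> l"
      by (cases "length p") auto
    \<comment> \<open>The first block has \<open>M\<close> vertices and fewer than 3 *
      \<open>M\<close> * (\<open>t\<close> + 1) follow it. As \<open>l\<close> \<ge> 2 *
      \<open>t\<close> + 1, the factor 128 leaves ample room.\<close>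
    have "n \<le> M * (3 * t + 4)" using t(2) by (simp add: algebra_simps)
    also have "\<dots> \<le> M * (128 * l)" using l(2) by (intro mult_le_mono2) auto
    finally have "n \<le> 128 * M * l" by (simp add: algebra_simps)
    then show ?thesis using p l(1) by blast
  qed
  then show ?thesis
    using contains_path_power_of_power_list M unfolding E_def by metis
qed

theorem theorem1:
  fixes n k :: nat
  assumes "n \<ge> 2" and "k \<ge> 2"
  shows "(\<forall>T :: 'a pair_pre_digraph. tournament T \<and> card (pverts T) = n \<longrightarrow>
            (\<exists>l :: nat. real l \<ge> real n / 2 ^ (6 * k + 7) \<and> contains_digraph T (path_power l k))) \<and>
         real (max_path_power n k) \<ge> real n / 2 ^ (6 * k + 7)"
proof -
  have bound: "real n / 2 ^ (6 * k + 7) \<le> real l \<longleftrightarrow> n \<le> 2 ^ (6 * k + 7) * l" for l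
  proof -
    have "real n / 2 ^ (6 * k + 7) \<le> real l \<longleftrightarrow> real n \<le> real (2 ^ (6 * k + 7) * l)"
      by (simp add: divide_le_eq mult.commute)
    then show ?thesis by (simp only: of_nat_le_iff)
  qed
  \<comment> \<open>The length found above may depend on the tournament. The least admissible
    \<open>l\<close> serves all tournaments, since path powers contain the shorter ones.\<close>
  define l where "l = (LEAST l. n \<le> 2 ^ (6 * k + 7) * l)"
  have l: "n \<le> 2 ^ (6 * k + 7) * l"
    unfolding l_def by (rule LeastI[of _ n]) simp
  have "contains_digraph T (path_power l k)"
    if "tournament T" "card (pverts T) = n" for T :: "nat pair_pre_digraph"
    using tournament_contains_long_path_power[OF that assms]
    unfolding l_def by (auto intro: contains_path_power_mono Least_le)
  then have "l \<le> max_path_power n k"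
    using max_path_power_iff[of n l k] assms(1) by auto
  then have "real n / 2 ^ (6 * k + 7) \<le> real (max_path_power n k)"
    using l bound le_trans mult_le_mono2 by metis
  then show ?thesis
    using tournament_contains_long_path_power assms bound by metis
qed

end
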